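(* Let $\alpha=(\alpha_1,\dots,\alpha_n)$ be nonnegative integers, $m=\sum_i\alpha_i$, and let $X=(x_1,\dots,x_n)$ and $Y=(y_1,\dots,y_k)$ be tuples of formal variables. Then there exists a sijection $$D(H(Y,X,\alpha))\;\longleftrightarrow\;\prod_{1\le i<j\le n}\{x_j,-x_i\}^{\alpha_i\alpha_j}.$$
   Context: A (weighted) signed set is a finite set $S$ with a weight function $w_S$ assigning to each element a signed product of formal variables ($\pm$ a monomial); $w(S)=\sum_{s\in S}w(s)$. For signed sets $A,B$: $A+B$ is the disjoint union with inherited weights; $-A$ is a copy of $A$ with negated weights; $A-B=A+(-B)$; $A\times B$ is the Cartesian product with $w((a,b))=w(a)w(b)$, and $A^k$ the $k$-fold product (with $A^0$ a single element of weight $1$). $\{x_j,-x_i\}$ denotes a two-element signed set with weights $x_j$ and $-x_i$. A sijection between signed sets $S$ and $T$ is an involution $f$ on $S\sqcup T$ such that $w(f(x))=-w(x)$ if $x$ and $f(x)$ lie in the same one of $S,T$, and $w(f(x))=w(x)$ otherwise. For formal variables $z_1,\dots,z_r$ and an integer $k$, $B((z_1,\dots,z_r),k)$ is the signed set of tuples $(a_1,\dots,a_r)$ of nonnegative integers with $\sum a_i=k$ (empty if $k<0$), with weight $\prod z_i^{a_i}$. For $\alpha,m\ge0$, $M(Y,x,\alpha,m)$ is the $\alpha\times m$ matrix of signed sets with $(i,j)$ entry $B((y_1,\dots,y_k,x,\dots,x),j-i)$, where $x$ is repeated $i$ times. $H(Y,X,\alpha)$ is the $m\times m$ block matrix obtained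 by stacking $M(Y,x_1,\alpha_1,m),\dots,M(Y,x_n,\alpha_n,m)$ vertically. For an $N\times N$ matrix $M$ of signed sets, $D(M)$ is the signed set $\{(\sigma,(m_1,\dots,m_N)):\sigma\in S_N,\ m_i\in M_{i,\sigma(i)}\}$ with weight $\mathrm{sgn}(\sigma)\prod_i w(m_i)$. *)

theory Defs
  imports "HOL-Library.Poly_Mapping" "HOL-Library.FuncSet"
    "HOL-Combinatorics.Permutations" "Jordan_Normal_Form.Matrix"
begin

text \<open>Weights live in the polynomial ring over the integers with indeterminates of type \<open>'v\<close>.\<close>

type_synonym 'v weight = "('v \<Rightarrow>\<^sub>0 nat) \<Rightarrow>\<^sub>0 int"

definition var :: "'v \<Rightarrow> 'v weight" where
  "var v = Poly_Mapping.single (Poly_Mapping.single v 1) 1"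

definition signed_monomial :: "'v weight \<Rightarrow> bool" where
  "signed_monomial p \<longleftrightarrow>
     (\<exists>t. p = Poly_Mapping.single t 1 \<or> p = - Poly_Mapping.single t 1)"

record ('a, 'v) sset =
  elems :: "'a set"
  wt :: "'a \<Rightarrow> 'v weight"

definition signed_set :: "('a, 'v) sset \<Rightarrow> bool" where
  "signed_set S \<longleftrightarrow> finite (elems S) \<and> (\<forall>s\<in>elems S. signed_monomial (wt S s))"

definition two_sset :: "'v weight \<Rightarrow> 'v weight \<Rightarrow> (bool, 'v) sset" where
  "two_sset p q = \<lparr>elems = UNIV, wt = (\<lambda>b. if b then p else q)\<rparr>"

text \<open>The Cartesian product of a family of signed sets over a finite index set; tuples are
  extensional functions.\<close>

definition sprod :: "'i set \<Rightarrow> ('i \<Rightarrow> ('a, 'v) sset) \<Rightarrow> ('i \<Rightarrow> 'a, 'v) sset" where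
  "sprod I A = \<lparr>elems = (\<Pi>\<^sub>E i\<in>I. elems (A i)), wt = (\<lambda>a. \<Prod>i\<in>I. wt (A i) (a i))\<rparr>"

definition spow :: "('a, 'v) sset \<Rightarrow> nat \<Rightarrow> (nat \<Rightarrow> 'a, 'v) sset" where
  "spow A k = sprod {..<k} (\<lambda>_. A)"

definition disj_sum :: "('a, 'v) sset \<Rightarrow> ('b, 'v) sset \<Rightarrow> ('a + 'b, 'v) sset" where
  "disj_sum S T = \<lparr>elems = elems S <+> elems T, wt = case_sum (wt S) (wt T)\<rparr>"

definition sijection :: "('a, 'v) sset \<Rightarrow> ('b, 'v) sset \<Rightarrow> ('a + 'b \<Rightarrow> 'a + 'b) \<Rightarrow> bool" where
  "sijection S T f \<longleftrightarrow>
     signed_set S \<and> signed_set T \<and>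
     (\<forall>x\<in>elems (disj_sum S T).
        f x \<in> elems (disj_sum S T) \<and> f (f x) = x \<and>
        wt (disj_sum S T) (f x) =
          (if isl (f x) = isl x then - wt (disj_sum S T) x else wt (disj_sum S T) x))"

definition B :: "'v list \<Rightarrow> int \<Rightarrow> (nat list, 'v) sset" where
  "B z k = \<lparr>elems = {a. length a = length z \<and> int (sum_list a) = k},
            wt = (\<lambda>a. \<Prod>i<length z. var (z ! i) ^ (a ! i))\<rparr>"

text \<open>Matrix indices start at 0, so the row with index \<open>i\<close> below is row \<open>i + 1\<close> in the usual
  numbering and has \<open>x\<close> repeated \<open>i + 1\<close> times; the difference of the indices is unaffected.\<close>

definition M :: "'v list \<Rightarrow> 'v \<Rightarrow> nat \<Rightarrow> nat \<Rightarrow> (nat list, 'v) sset mat" where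
  "M Y x a m = mat a m (\<lambda>(i, j). B (Y @ replicate (Suc i) x) (int j - int i))"

definition H :: "'v list \<Rightarrow> 'v list \<Rightarrow> nat list \<Rightarrow> (nat list, 'v) sset mat" where
  "H Y X \<alpha> =
     mat_of_rows_list (sum_list \<alpha>)
       (concat (map (\<lambda>(x, a). mat_to_list (M Y x a (sum_list \<alpha>))) (zip X \<alpha>)))"

text \<open>Meant for square matrices.\<close>

definition D :: "('a, 'v) sset mat \<Rightarrow> ((nat \<Rightarrow> nat) \<times> (nat \<Rightarrow> 'a), 'v) sset" where
  "D A = \<lparr>elems = (SIGMA \<sigma>:{\<sigma>. \<sigma> permutes {0..<dim_row A}}.
                    \<Pi>\<^sub>E i\<in>{0..<dim_row A}. elems (A $$ (i, \<sigma> i))),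
          wt = (\<lambda>(\<sigma>, a). of_int (sign \<sigma>) * (\<Prod>i = 0..<dim_row A. wt (A $$ (i, \<sigma> i)) (a i)))\<rparr>"

end

theory Submission
  imports Defs "Jordan_Normal_Form.Determinant"
    "HOL-Computational_Algebra.Formal_Power_Series"
begin

text \<open>A sijection between two signed sets exists as soon as their total weights agree: after negating
  one side, elements of opposite weight can be paired off greedily. It remains to evaluate a
  determinant. The entries in row \<open>i\<close> (counted from 0) of the block of \<open>x\<close> are the coefficients of the
  power series \<open>t\<^sup>i (1 - x t)\<^sup>-\<^sup>i\<^sup>-\<^sup>1 \<Prod>y. (1 - y t)\<^sup>-\<^sup>1\<close>. Splitting off the factor that depends
  on \<open>Y\<close> leaves the confluent Vandermonde matrix with entries \<open>(j choose i) x\<^sup>j\<^sup>-\<^sup>i\<close>, the \<open>i\<close>-th Taylor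
  coefficients at \<open>x\<close> of the monomials \<open>t\<^sup>j\<close>. In the Newton basis attached to the sequence of nodes
  this matrix is lower triangular.\<close>

section \<open>Sijections from equality of total weights\<close>

lemma signed_monomial_one: "signed_monomial 1"
  unfolding signed_monomial_def by (rule exI[of _ 0]) simp

lemma signed_monomial_var: "signed_monomial (var v)"
  by (auto simp: signed_monomial_def var_def)

lemma signed_monomial_uminus: "signed_monomial p \<Longrightarrow> signed_monomial (- p)"
  by (auto simp: signed_monomial_def)

lemma signed_monomial_mult:
  assumes "signed_monomial p" "signed_monomial q"
  shows "signed_monomial (p * q)"
proof -
  obtain s t where "p = Poly_Mapping.single s 1 \<or> p = - Poly_Mapping.single s 1"
    "q = Poly_Mapping.single t 1 \<or> q = - Poly_Mapping.single t 1"
    using assms by (auto simp: signed_monomial_def)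
  then show ?thesis
    unfolding signed_monomial_def by (intro exI[of _ "s + t"]) (auto simp: mult_single)
qed

lemma signed_monomial_prod:
  "(\<And>i. i \<in> I \<Longrightarrow> signed_monomial (f i)) \<Longrightarrow> signed_monomial (\<Prod>i\<in>I. f i)"
  by (induction I rule: infinite_finite_induct)
    (auto intro: signed_monomial_one signed_monomial_mult)

lemma signed_monomial_power: "signed_monomial p \<Longrightarrow> signed_monomial (p ^ k)"
  by (induction k) (auto intro: signed_monomial_one signed_monomial_mult)

lemma signed_monomial_nonzero: "signed_monomial p \<Longrightarrow> p \<noteq> 0"
  by (auto simp: signed_monomial_def)

text \<open>Each side has only one nonzero coefficient, equal to 1 or -1, so a shared exponent
  leaves only the sign undetermined.\<close>

lemma signed_monomial_eq_or_eq_uminus: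
  assumes "signed_monomial p" "signed_monomial q"
    and "Poly_Mapping.lookup p t \<noteq> 0" "Poly_Mapping.lookup q t \<noteq> 0"
  shows "q = p \<or> q = - p"
  using assms by (auto simp: signed_monomial_def lookup_single when_def split: if_splits)

text \<open>Otherwise every weight involving the monomial of \<open>u x\<close> equals
  \<open>u x\<close>, and contributions of equal sign cannot cancel in the sum.\<close>

lemma exists_opposite_monomial:
  fixes u :: "'a \<Rightarrow> 'v weight"
  assumes "finite E" "\<And>e. e \<in> E \<Longrightarrow> signed_monomial (u e)" "(\<Sum>e\<in>E. u e) = 0" "x \<in> E"
  shows "\<exists>y\<in>E. u y = - u x"
proof (rule ccontr)
  assume no: "\<not> ?thesis"
  obtain t where t: "Poly_Mapping.lookup (u x) t \<noteq> 0"
    using signed_monomial_nonzero[OF assms(2)[OF assms(4)]] poly_mapping_eqI[of "u x" 0] by auto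
  let ?c = "Poly_Mapping.lookup (u x) t"
  \<comment> \<open>The factor \<open>?c\<close> normalises the sign of \<open>u x\<close>, so that
    both signs are treated at once.\<close>
  have nonneg: "0 \<le> ?c * Poly_Mapping.lookup (u e) t" if "e \<in> E" for e
  proof (cases "Poly_Mapping.lookup (u e) t = 0")
    case False
    then have "u e = u x"
      using signed_monomial_eq_or_eq_uminus[OF assms(2)[OF assms(4)] assms(2)[OF that] t]
        no that by auto
    then show ?thesis by simp
  qed simp
  have "0 < ?c * ?c" using t by (simp add: zero_less_mult_iff) linarith
  then have "0 < (\<Sum>e\<in>E. ?c * Poly_Mapping.lookup (u e) t)"
    using assms(1,4) nonneg by (intro sum_pos2[of E x]) auto
  also have "\<dots> = ?c * Poly_Mapping.lookup (\<Sum>e\<in>E. u e) t"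
    by (simp add: lookup_sum sum_distrib_left)
  finally show False using assms(3) by simp
qed

text \<open>Removing an opposite pair keeps the total weight zero, so pairs can be split off by
  induction on the set.\<close>

lemma sign_reversing_involution:
  fixes u :: "'a \<Rightarrow> 'v weight"
  assumes "finite E" "\<And>e. e \<in> E \<Longrightarrow> signed_monomial (u e)" "(\<Sum>e\<in>E. u e) = 0"
  shows "\<exists>f. \<forall>e\<in>E. f e \<in> E \<and> f (f e) = e \<and> u (f e) = - u e"
  using assms
proof (induction E rule: finite_psubset_induct)
  case (psubset E)
  show ?case
  proof (cases "E = {}")
    case False
    then obtain x where x: "x \<in> E" by blast
    obtain y where y: "y \<in> E" "u y = - u x"
      using exists_opposite_monomial[of E u x] psubset x by blast
    \<comment> \<open>Over the integers no nonzero weight is its own negative; hence the partner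
      \<open>y\<close> differs from \<open>x\<close>.\<close>
    have ux: "u x \<noteq> - u x"
    proof
      assume "u x = - u x"
      then have "Poly_Mapping.lookup (u x) t = 0" for t
        by (metis lookup_uminus neg_equal_zero)
      then show False
        using signed_monomial_nonzero[OF psubset.prems(1)[OF x]] by (auto intro: poly_mapping_eqI)
    qed
    then have xy: "x \<noteq> y" using y by auto
    let ?E = "E - {x, y}"
    have "(\<Sum>e\<in>E. u e) = (\<Sum>e\<in>?E. u e) + (u x + u y)"
      using sum.subset_diff[of "{x, y}" E u] psubset.hyps(1) x y xy by simp
    then have "(\<Sum>e\<in>?E. u e) = 0" using psubset.prems(2) y by simp
    moreover have "?E \<subset> E" using x by blast
    ultimately obtain f where f: "\<forall>e\<in>?E. f e \<in> ?E \<and> f (f e) = e \<and> u (f e) = - u e"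
      using psubset.IH[of ?E] psubset.prems(1) by auto
    \<comment> \<open>\<open>f\<close> is specified only on \<open>?E\<close> and maps it to itself,
      so redefining it at \<open>x\<close> and \<open>y\<close> does not interfere.\<close>
    let ?f = "f(x := y, y := x)"
    have "\<forall>e\<in>E. ?f e \<in> E \<and> ?f (?f e) = e \<and> u (?f e) = - u e"
    proof
      fix e assume e: "e \<in> E"
      show "?f e \<in> E \<and> ?f (?f e) = e \<and> u (?f e) = - u e"
      proof (cases "e = x \<or> e = y")
        case True
        then show ?thesis using x y xy by auto
      next
        case False
        then have "f e \<in> ?E" "f (f e) = e" "u (f e) = - u e" using f e by auto
        then show ?thesis using False by auto
      qed
    qed
    then show ?thesis by blast
  qed simp
qed

definition total_weight :: "('a, 'v) sset \<Rightarrow> 'v weight" where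
  "total_weight S = (\<Sum>s\<in>elems S. wt S s)"

theorem sijection_exists:
  assumes "signed_set S" "signed_set T" "total_weight S = total_weight T"
  shows "\<exists>f. sijection S T f"
proof -
  \<comment> \<open>Negating the weights of one side turns a sijection into a sign-reversing involution.\<close>
  define u where "u = case_sum (wt S) (\<lambda>t. - wt T t)"
  let ?E = "elems S <+> elems T"
  have fin: "finite (elems S)" "finite (elems T)" using assms by (auto simp: signed_set_def)
  have "(\<Sum>e\<in>?E. u e) = 0"
    using fin assms(3) by (simp add: sum.Plus u_def total_weight_def sum_negf)
  moreover have "signed_monomial (u e)" if "e \<in> ?E" for e
    using assms(1,2) that signed_monomial_uminus
    by (cases e) (auto simp: u_def signed_set_def)
  ultimately obtain f
    where f: "\<And>e. e \<in> ?E \<Longrightarrow> f e \<in> ?E \<and> f (f e) = e \<and> u (f e) = - u e"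
    using sign_reversing_involution[of ?E u] fin by (metis finite_Plus)
  moreover have "wt (disj_sum S T) (f e) =
      (if isl (f e) = isl e then - wt (disj_sum S T) e else wt (disj_sum S T) e)"
    if "e \<in> ?E" for e
    using f[OF that] by (cases e; cases "f e") (auto simp: u_def disj_sum_def minus_equation_iff)
  moreover have "elems (disj_sum S T) = ?E"
    by (simp add: disj_sum_def)
  ultimately have "sijection S T f"
    unfolding sijection_def using f assms(1,2) by presburger
  then show ?thesis by blast
qed

section \<open>Total weights of the constructions\<close>

lemma signed_set_sprod:
  assumes "finite I" "\<And>i. i \<in> I \<Longrightarrow> signed_set (A i)"
  shows "signed_set (sprod I A)"
  using assms by (auto simp: signed_set_def sprod_def PiE_mem
      intro!: finite_PiE signed_monomial_prod)

lemma total_weight_sprod: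
  assumes "finite I" "\<And>i. i \<in> I \<Longrightarrow> signed_set (A i)"
  shows "total_weight (sprod I A) = (\<Prod>i\<in>I. total_weight (A i))"
  unfolding total_weight_def sprod_def using assms
  by (simp add: prod_sum_PiE signed_set_def)

lemma signed_set_spow: "signed_set A \<Longrightarrow> signed_set (spow A k)"
  by (simp add: spow_def signed_set_sprod)

lemma total_weight_spow: "signed_set A \<Longrightarrow> total_weight (spow A k) = total_weight A ^ k"
  by (simp add: spow_def total_weight_sprod)

lemma signed_set_two_sset:
  "signed_monomial p \<Longrightarrow> signed_monomial q \<Longrightarrow> signed_set (two_sset p q)"
  by (simp add: signed_set_def two_sset_def)

lemma total_weight_two_sset: "total_weight (two_sset p q) = p + q"
  by (simp add: total_weight_def two_sset_def UNIV_bool add.commute)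

lemma signed_set_D:
  assumes "\<And>i j. i < dim_row A \<Longrightarrow> j < dim_row A \<Longrightarrow> signed_set (A $$ (i, j))"
  shows "signed_set (D A)"
proof -
  have entry: "signed_set (A $$ (i, \<sigma> i))" if "\<sigma> permutes {0..<dim_row A}" "i < dim_row A" for \<sigma> i
    using assms that permutes_in_image[OF that(1), of i] by simp
  have "signed_monomial (wt (D A) s)" if s: "s \<in> elems (D A)" for s
  proof -
    obtain \<sigma> a where s': "s = (\<sigma>, a)" "\<sigma> permutes {0..<dim_row A}"
      "a \<in> (\<Pi>\<^sub>E i\<in>{0..<dim_row A}. elems (A $$ (i, \<sigma> i)))"
      using s by (auto simp: D_def)
    have "signed_monomial (\<Prod>i = 0..<dim_row A. wt (A $$ (i, \<sigma> i)) (a i))"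
      using entry[OF s'(2)] s'(3) by (intro signed_monomial_prod) (force simp: signed_set_def dest: PiE_mem)
    then show ?thesis
      by (auto simp: D_def s'(1) sign_def intro: signed_monomial_uminus)
  qed
  moreover have "finite (elems (D A))"
    using entry by (auto simp: D_def signed_set_def finite_permutations intro!: finite_PiE)
  ultimately show ?thesis by (simp add: signed_set_def)
qed

text \<open>For a fixed permutation, the sum over choices of entries factors by distributivity; what
  remains is the Leibniz formula.\<close>

lemma total_weight_D:
  assumes "A \<in> carrier_mat n n" "\<And>i j. i < n \<Longrightarrow> j < n \<Longrightarrow> signed_set (A $$ (i, j))"
  shows "total_weight (D A) = det (map_mat total_weight A)"
proof -
  let ?P = "{\<sigma>. \<sigma> permutes {0..<n}}"
  have dim: "dim_row A = n" "dim_col A = n" using assms(1) by auto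
  have entry: "finite (elems (A $$ (i, \<sigma> i)))" "\<sigma> i < n" if "\<sigma> \<in> ?P" "i < n" for \<sigma> i
    using assms(2) that permutes_in_image[of \<sigma> "{0..<n}" i] by (auto simp: signed_set_def)
  have "total_weight (D A) = (\<Sum>\<sigma>\<in>?P. \<Sum>a\<in>(\<Pi>\<^sub>E i\<in>{0..<n}. elems (A $$ (i, \<sigma> i))).
      of_int (sign \<sigma>) * (\<Prod>i = 0..<n. wt (A $$ (i, \<sigma> i)) (a i)))"
    unfolding total_weight_def D_def dim using entry
    by (subst sum.Sigma) (auto simp: finite_permutations intro!: finite_PiE)
  also have "\<dots> = (\<Sum>\<sigma>\<in>?P. of_int (sign \<sigma>) * (\<Prod>i = 0..<n. total_weight (A $$ (i, \<sigma> i))))"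
    unfolding total_weight_def using entry
    by (intro sum.cong refl) (subst prod_sum_PiE, auto simp: sum_distrib_left)
  also have "\<dots> = (\<Sum>\<sigma>\<in>?P. of_int (sign \<sigma>) * (\<Prod>i = 0..<n. map_mat total_weight A $$ (i, \<sigma> i)))"
    using entry dim by (intro sum.cong refl arg_cong2[where f = "(*)"] prod.cong) auto
  also have "\<dots> = det (map_mat total_weight A)"
    using assms(1) by (simp add: det_def'[of _ n])
  finally show ?thesis .
qed

text \<open>The series \<open>1 / (1 - x t)\<close>, given by its coefficients so that no inverse
  has to be formed.\<close>

definition geometric_fps :: "'a::comm_ring_1 \<Rightarrow> 'a fps" where
  "geometric_fps x = Abs_fps (\<lambda>n. x ^ n)"

lemma signed_set_B: "signed_set (B z k)"
proof -
  \<comment> \<open>No entry exceeds the sum \<open>k\<close>; for negative \<open>k\<close> the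
    left side is empty.\<close>
  have "elems (B z k) \<subseteq> {a. set a \<subseteq> {..nat k} \<and> length a = length z}"
    by (auto simp: B_def dest: member_le_sum_list)
  then have "finite (elems (B z k))"
    by (rule finite_subset) (simp add: finite_lists_length_eq)
  then show ?thesis
    by (auto simp: signed_set_def B_def
        intro!: signed_monomial_prod signed_monomial_power signed_monomial_var)
qed

text \<open>The total weight is the complete homogeneous symmetric polynomial, here read off its
  generating function. The coefficient formula \<open>fps_prod_nth\<close> runs over
  \<open>0..n\<close>, hence at least one variable.\<close>

lemma total_weight_B:
  assumes "z \<noteq> []"
  shows "total_weight (B z (int k)) = fps_nth (prod_list (map (\<lambda>v. geometric_fps (var v)) z)) k"
proof -
  obtain n where n: "length z = Suc n" using assms by (cases z) auto
  have "prod_list (map (\<lambda>v. geometric_fps (var v)) z) = (\<Prod>i = 0..n. geometric_fps (var (z ! i)))"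
    using n by (simp add: prod.list_conv_set_nth atLeastLessThanSuc_atLeastAtMost)
  also have "fps_nth \<dots> k = (\<Sum>a\<in>natpermute k (n + 1). \<Prod>i = 0..n. var (z ! i) ^ (a ! i))"
    by (simp only: fps_prod_nth geometric_fps_def fps_nth_Abs_fps)
  also have "\<dots> = total_weight (B z (int k))"
    using n by (simp add: total_weight_def B_def natpermute_def lessThan_Suc_atMost atMost_atLeast0
        conj_commute)
  finally show ?thesis by simp
qed

lemma total_weight_B_negative: "k < 0 \<Longrightarrow> total_weight (B z k) = 0"
  by (auto simp: total_weight_def B_def intro!: sum.neutral)

section \<open>The confluent Vandermonde determinant\<close>

text \<open>Each further geometric factor sums up binomial coefficients along a diagonal of Pascal's
  triangle (hockey-stick identity).\<close>

lemma fps_nth_geometric_power: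
  "fps_nth (geometric_fps x ^ Suc i) n = of_nat ((n + i) choose i) * x ^ n"
proof (induction i arbitrary: n)
  case (Suc i)
  have "fps_nth (geometric_fps x ^ Suc (Suc i)) n
      = (\<Sum>k=0..n. of_nat ((k + i) choose i) * x ^ k * x ^ (n - k))"
    by (subst power_Suc2) (simp only: fps_mult_nth Suc.IH, simp add: geometric_fps_def)
  also have "\<dots> = (\<Sum>k\<le>n. of_nat ((i + k) choose i)) * x ^ n"
    by (simp add: sum_distrib_right atMost_atLeast0 mult.assoc add.commute flip: power_add)
  also have "(\<Sum>k\<le>n. of_nat ((i + k) choose i)) = of_nat ((n + Suc i) choose Suc i)"
    using choose_rising_sum(1)[of i n] by (simp add: add.commute flip: of_nat_sum)
  finally show ?case .
qed (simp add: geometric_fps_def)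

text \<open>The shift by \<open>i\<close> turns the coefficients into confluent Vandermonde entries;
  for \<open>l < i\<close> both sides vanish.\<close>

lemma fps_nth_X_power_geometric_power:
  "fps_nth (fps_X ^ i * geometric_fps x ^ Suc i) l = of_nat (l choose i) * x ^ (l - i)"
  by (subst fps_X_power_mult_nth) (simp add: fps_nth_geometric_power binomial_eq_0 del: power_Suc)

text \<open>The coefficient of \<open>t ^ i\<close> in \<open>p (x + t)\<close>: the
  \<open>i\<close>-th derivative at \<open>x\<close> over \<open>i!\<close>, but free of division
  and so meaningful in any commutative ring.\<close>

definition taylor_coeff :: "'a::comm_ring_1 \<Rightarrow> nat \<Rightarrow> 'a poly \<Rightarrow> 'a" where
  "taylor_coeff x i p = coeff (pcompose p [:x, 1:]) i"

lemma pcompose_power: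
  fixes p :: "'a::comm_semiring_1 poly"
  shows "pcompose (p ^ n) q = pcompose p q ^ n"
  by (induction n) (simp_all add: pcompose_1 pcompose_mult)

text \<open>Substituting \<open>x + t\<close> turns the power of the linear factor into
  \<open>t ^ e\<close>, which shifts coefficients by \<open>e\<close>.\<close>

lemma taylor_coeff_linear_power_mult:
  "taylor_coeff x i (p * [:-x, 1:] ^ e) = (if i < e then 0 else taylor_coeff x (i - e) p)"
proof -
  have "pcompose ([:-x, 1:] ^ e) [:x, 1:] = monom 1 e"
    by (simp add: pcompose_power pcompose_pCons monom_altdef)
  then show ?thesis
    by (simp add: taylor_coeff_def pcompose_mult mult.commute[of _ "monom 1 e"] coeff_monom_mult)
qed

lemma taylor_coeff_0: "taylor_coeff x 0 p = poly p x"
  by (simp add: taylor_coeff_def poly_pcompose flip: poly_0_coeff_0)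

text \<open>Linearity and the binomial theorem. This is a row of the confluent Vandermonde matrix
  times the coefficient vector of \<open>p\<close>; \<open>m\<close> will be the matrix
  size.\<close>

lemma taylor_coeff_conv_sum:
  assumes "\<And>l. l \<ge> m \<Longrightarrow> coeff p l = 0"
  shows "taylor_coeff x i p = (\<Sum>l<m. of_nat (l choose i) * x ^ (l - i) * coeff p l)"
proof -
  have "p = (\<Sum>l<m. monom (coeff p l) l)"
    by (rule poly_eqI) (auto simp: coeff_sum assms not_less)
  then have "pcompose p [:x, 1:] = pcompose (\<Sum>l<m. monom (coeff p l) l) [:x, 1:]"
    by (rule arg_cong)
  then have "taylor_coeff x i p = (\<Sum>l<m. coeff p l * coeff ([:x, 1:] ^ l) i)"
    by (simp add: taylor_coeff_def pcompose_sum coeff_sum monom_altdef pcompose_smult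
        pcompose_power pcompose_pCons)
  also have "\<dots> = (\<Sum>l<m. of_nat (l choose i) * x ^ (l - i) * coeff p l)"
  proof (rule sum.cong[OF refl])
    fix l
    show "coeff p l * coeff ([:x, 1:] ^ l) i = of_nat (l choose i) * x ^ (l - i) * coeff p l"
    proof (cases "i \<le> l")
      case True
      then show ?thesis by (simp add: coeff_linear_poly_power)
    next
      case False
      have "degree ([:x, 1:] ^ l) \<le> l"
        using degree_power_le[of "[:x, 1:]" l] by (auto intro: order_trans)
      then show ?thesis using False by (simp add: coeff_eq_0 binomial_eq_0)
    qed
  qed
  finally show ?thesis .
qed

section \<open>Newton polynomials for nodes with multiplicities\<close>

definition newton_poly :: "'a::comm_ring_1 list \<Rightarrow> 'a poly" where
  "newton_poly zs = prod_list (map (\<lambda>z. [:-z, 1:]) zs)"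

lemma coeff_newton_poly:
  "length zs \<le> l \<Longrightarrow> coeff (newton_poly zs) l = (if l = length zs then 1 else 0)"
proof (induction zs arbitrary: l)
  case (Cons z zs)
  then show ?case by (cases l) (auto simp: newton_poly_def)
qed (auto simp: newton_poly_def)

text \<open>The rows of the stacked matrix: row \<open>i\<close> of the block belonging to \<open>x\<close> is labelled
  \<open>(x, i)\<close>.\<close>

definition row_labels :: "('a \<times> nat) list \<Rightarrow> ('a \<times> nat) list" where
  "row_labels ps = concat (map (\<lambda>(x, a). map (Pair x) [0..<a]) ps)"

lemma row_labels_snoc:
  "row_labels (ps @ [(x, a)]) = row_labels ps @ map (Pair x) [0..<a]"
  by (simp add: row_labels_def)

lemma length_row_labels: "length (row_labels ps) = sum_list (map snd ps)"
  by (simp add: row_labels_def length_concat comp_def case_prod_beta)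

text \<open>The Newton basis polynomial whose nodes are those of the rows before row
  \<open>j\<close>, so a node repeats as often as it has labelled rows.\<close>

definition row_newton_poly :: "('a::comm_ring_1 \<times> nat) list \<Rightarrow> nat \<Rightarrow> 'a poly" where
  "row_newton_poly rs j = newton_poly (map fst (take j rs))"

lemma row_newton_poly_append:
  "j \<le> length rs \<Longrightarrow> row_newton_poly (rs @ rs') j = row_newton_poly rs j"
  by (simp add: row_newton_poly_def)

lemma row_newton_poly_in_block:
  assumes "i \<le> a"
  shows "row_newton_poly (rs @ map (Pair x) [0..<a]) (length rs + i)
       = newton_poly (map fst rs) * [:-x, 1:] ^ i"
proof -
  have "map fst (take (length rs + i) (rs @ map (Pair x) [0..<a])) = map fst rs @ replicate i x"
    using assms by (simp add: take_map comp_def map_replicate_const)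
  then show ?thesis
    by (simp add: row_newton_poly_def newton_poly_def)
qed

text \<open>The rows \<open>(x, 0), ..., (x, i - 1)\<close> of the same block precede row
  \<open>(x, i)\<close> and supply \<open>i\<close> factors; \<open>q\<close> collects the earlier
  blocks.\<close>

lemma row_newton_poly_factor:
  assumes "r < length (row_labels ps)" "row_labels ps ! r = (x, i)"
  shows "\<exists>q. row_newton_poly (row_labels ps) r = q * [:-x, 1:] ^ i"
  using assms
proof (induction ps arbitrary: r rule: rev_induct)
  case (snoc p ps)
  obtain y a where p: "p = (y, a)" by fastforce
  show ?case
  proof (cases "r < length (row_labels ps)")
    case True
    then show ?thesis
      using snoc by (auto simp: p row_labels_snoc nth_append row_newton_poly_append)
  next
    case False
    then have "r = length (row_labels ps) + i" "x = y" "i < a"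
      using snoc.prems by (auto simp: p row_labels_snoc nth_append)
    then show ?thesis
      using row_newton_poly_in_block[of i a "row_labels ps" x] by (auto simp: p row_labels_snoc)
  qed
qed (simp add: row_labels_def)

lemma row_newton_poly_dvd:
  assumes "r \<le> j"
  shows "row_newton_poly rs r dvd row_newton_poly rs j"
proof -
  have "take j rs = take r rs @ take (j - r) (drop r rs)"
    using assms by (metis le_add_diff_inverse take_add)
  then show ?thesis by (simp add: row_newton_poly_def newton_poly_def)
qed

text \<open>This is lower triangularity: for \<open>j > r\<close> the node of row \<open>r\<close>
  itself is included too, so the linear factor at \<open>x\<close> occurs at least
  \<open>i + 1\<close> times and kills the \<open>i\<close>-th Taylor coefficient.\<close>

lemma taylor_coeff_row_newton_poly_eq_0:
  assumes "r < j" "j \<le> length (row_labels ps)" "row_labels ps ! r = (x, i)"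
  shows "taylor_coeff x i (row_newton_poly (row_labels ps) j) = 0"
proof -
  let ?R = "row_labels ps"
  have r: "r < length ?R" using assms by simp
  obtain q where "row_newton_poly ?R r = q * [:-x, 1:] ^ i"
    using row_newton_poly_factor[OF r assms(3)] by blast
  then have "row_newton_poly ?R (Suc r) = q * [:-x, 1:] ^ Suc i"
    using assms(3) r
    by (simp add: row_newton_poly_def newton_poly_def take_Suc_conv_app_nth mult_ac)
  moreover obtain q' where "row_newton_poly ?R j = row_newton_poly ?R (Suc r) * q'"
    using row_newton_poly_dvd[of "Suc r" j ?R] assms(1) by auto
  ultimately have "row_newton_poly ?R j = (q * q') * [:-x, 1:] ^ Suc i"
    by (simp only: mult_ac)
  then show ?thesis by (simp only: taylor_coeff_linear_power_mult) simp
qed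

lemma poly_newton_poly_row_labels:
  "poly (newton_poly (map fst (row_labels ps))) x
     = (\<Prod>i<length ps. (x - fst (ps ! i)) ^ snd (ps ! i))"
proof (induction ps rule: rev_induct)
  case (snoc p ps)
  obtain y a where p: "p = (y, a)" by fastforce
  have "poly (newton_poly (map fst (row_labels (ps @ [p])))) x
      = poly (newton_poly (map fst (row_labels ps))) x * (x - y) ^ a"
    by (simp add: p row_labels_snoc newton_poly_def comp_def map_replicate_const)
  then show ?case using snoc by (simp add: p nth_append)
qed (simp add: row_labels_def newton_poly_def)

lemma prod_lessThan_add:
  fixes f :: "nat \<Rightarrow> 'a::comm_monoid_mult"
  shows "(\<Prod>r<n + k. f r) = (\<Prod>r<n. f r) * (\<Prod>r<k. f (n + r))"
  by (induction k) (simp_all add: mult.assoc)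

text \<open>Induction on the number of blocks: appending a block leaves the earlier diagonal entries
  unchanged and adds exactly the pairs whose larger index is the new block.\<close>

lemma prod_taylor_coeff_row_newton_poly:
  fixes ps :: "('a::comm_ring_1 \<times> nat) list"
  defines "R \<equiv> row_labels ps"
  shows "(\<Prod>r<length R. taylor_coeff (fst (R ! r)) (snd (R ! r)) (row_newton_poly R r))
       = (\<Prod>(i, j)\<in>{(i, j). i < j \<and> j < length ps}.
            (fst (ps ! j) - fst (ps ! i)) ^ (snd (ps ! i) * snd (ps ! j)))"
  unfolding R_def
proof (induction ps rule: rev_induct)
  case (snoc p ps)
  obtain x a where p: "p = (x, a)" by fastforce
  let ?R = "row_labels ps" and ?n = "length ps"
  let ?R' = "row_labels (ps @ [p])"
  let ?f = "\<lambda>R r. taylor_coeff (fst (R ! r)) (snd (R ! r)) (row_newton_poly R r)"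
  let ?g = "\<lambda>ps (i, j). (fst (ps ! j) - fst (ps ! i)) ^ (snd (ps ! i) * snd (ps ! j))"
  have R': "?R' = ?R @ map (Pair x) [0..<a]" by (simp add: p row_labels_snoc)
  have "(\<Prod>r<length ?R'. ?f ?R' r) = (\<Prod>r<length ?R. ?f ?R' r) * (\<Prod>k<a. ?f ?R' (length ?R + k))"
    by (simp add: R' prod_lessThan_add)
  also have "(\<Prod>r<length ?R. ?f ?R' r) = (\<Prod>r<length ?R. ?f ?R r)"
    by (intro prod.cong refl) (simp add: R' nth_append row_newton_poly_append)
  also have "\<dots> = (\<Prod>q\<in>{(i, j). i < j \<and> j < ?n}. ?g ps q)"
    by (rule snoc.IH)
  also have "\<dots> = (\<Prod>q\<in>{(i, j). i < j \<and> j < ?n}. ?g (ps @ [p]) q)"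
    by (intro prod.cong refl) (auto simp: nth_append)
  \<comment> \<open>In row \<open>k\<close> of the new block the \<open>k\<close> factors at
    \<open>x\<close> reduce the Taylor index to 0. All \<open>a\<close> rows thus give the same
    value, that of the Newton polynomial of the earlier blocks at \<open>x\<close>.\<close>
  also have "(\<Prod>k<a. ?f ?R' (length ?R + k)) = (\<Prod>i<?n. (x - fst (ps ! i)) ^ snd (ps ! i)) ^ a"
    by (simp add: R' nth_append row_newton_poly_in_block taylor_coeff_linear_power_mult
        taylor_coeff_0 poly_newton_poly_row_labels)
  also have "\<dots> = (\<Prod>i<?n. ?g (ps @ [p]) (i, ?n))"
    by (simp add: nth_append p power_mult prod_power_distrib)
  also have "\<dots> = (\<Prod>q\<in>(\<lambda>i. (i, ?n)) ` {..<?n}. ?g (ps @ [p]) q)"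
    by (subst prod.reindex) (auto simp: inj_on_def)
  also have "(\<Prod>q\<in>{(i, j). i < j \<and> j < ?n}. ?g (ps @ [p]) q) * \<dots>
      = (\<Prod>q\<in>{(i, j). i < j \<and> j < ?n} \<union> (\<lambda>i. (i, ?n)) ` {..<?n}. ?g (ps @ [p]) q)"
    by (subst prod.union_disjoint)
      (auto intro: finite_subset[of _ "{..<?n} \<times> {..<?n}"])
  also have "{(i, j). i < j \<and> j < ?n} \<union> (\<lambda>i. (i, ?n)) ` {..<?n}
      = {(i, j). i < j \<and> j < length (ps @ [p])}"
    by auto
  finally show ?case .
qed (simp add: row_labels_def)

section \<open>Evaluation by triangular factorisation\<close>

lemma det_unit_upper_triangular:
  assumes "A \<in> carrier_mat n n" "\<And>i j. j < i \<Longrightarrow> i < n \<Longrightarrow> A $$ (i, j) = 0"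
    "\<And>i. i < n \<Longrightarrow> A $$ (i, i) = 1"
  shows "det A = 1"
proof -
  have "det A = prod_list (diag_mat A)"
    using assms by (intro det_upper_triangular[of _ n]) (auto simp: upper_triangular_def)
  also have "\<dots> = 1"
    using assms by (auto simp: diag_mat_def prod.list_conv_set_nth)
  finally show ?thesis .
qed

lemma det_confluent_vandermonde:
  fixes ps :: "('a::comm_ring_1 \<times> nat) list"
  defines "R \<equiv> row_labels ps"
  shows "det (mat (length R) (length R)
           (\<lambda>(r, l). of_nat (l choose snd (R ! r)) * fst (R ! r) ^ (l - snd (R ! r))))
       = (\<Prod>(i, j)\<in>{(i, j). i < j \<and> j < length ps}.
            (fst (ps ! j) - fst (ps ! i)) ^ (snd (ps ! i) * snd (ps ! j)))"
    (is "det ?V = _")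
proof -
  let ?m = "length R"
  \<comment> \<open>Column operations replace the monomials by the Newton basis, which makes the matrix of
    Taylor coefficients lower triangular.\<close>
  define C where "C = mat ?m ?m (\<lambda>(l, j). coeff (row_newton_poly R j) l)"
  define L where "L = mat ?m ?m
    (\<lambda>(r, j). taylor_coeff (fst (R ! r)) (snd (R ! r)) (row_newton_poly R j))"
  \<comment> \<open>Used twice: for the unit diagonal and zeros below it in \<open>C\<close>, and
    for the absence of terms of degree \<open>?m\<close> or more when expanding row entries.\<close>
  have coeff: "coeff (row_newton_poly R j) l = (if l = j then 1 else 0)" if "j \<le> l" "j \<le> ?m" for j l
    using that coeff_newton_poly[of "map fst (take j R)" l] by (auto simp: row_newton_poly_def)
  have "det C = 1"
    by (rule det_unit_upper_triangular[of _ ?m]) (auto simp: C_def coeff)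
  moreover have "?V * C = L"
  proof (rule eq_matI)
    fix r j assume rj: "r < dim_row L" "j < dim_col L"
    have "taylor_coeff (fst (R ! r)) (snd (R ! r)) (row_newton_poly R j) =
      (\<Sum>l<?m. of_nat (l choose snd (R ! r)) * fst (R ! r) ^ (l - snd (R ! r))
         * coeff (row_newton_poly R j) l)"
      using rj by (intro taylor_coeff_conv_sum) (auto simp: L_def coeff)
    then show "(?V * C) $$ (r, j) = L $$ (r, j)"
      using rj by (simp add: L_def C_def scalar_prod_def lessThan_atLeast0)
  qed (auto simp: L_def C_def)
  ultimately have "det ?V = det L"
    using det_mult[of ?V ?m C] by (simp add: C_def)
  also have "det L = prod_list (diag_mat L)"
    by (rule det_lower_triangular[of ?m])
      (auto simp: L_def R_def intro!: taylor_coeff_row_newton_poly_eq_0)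
  also have "\<dots> = (\<Prod>r<?m. taylor_coeff (fst (R ! r)) (snd (R ! r)) (row_newton_poly R r))"
    by (simp add: diag_mat_def prod.list_conv_set_nth L_def lessThan_atLeast0)
  also have "\<dots> = (\<Prod>(i, j)\<in>{(i, j). i < j \<and> j < length ps}.
      (fst (ps ! j) - fst (ps ! i)) ^ (snd (ps ! i) * snd (ps ! j)))"
    unfolding R_def by (rule prod_taylor_coeff_row_newton_poly)
  finally show ?thesis .
qed

section \<open>The determinant of the block matrix\<close>

lemma H_conv_row_labels:
  assumes "length X = length \<alpha>"
  defines "R \<equiv> row_labels (zip X \<alpha>)"
  shows "H Y X \<alpha> = mat (length R) (length R)
    (\<lambda>(r, j). B (Y @ replicate (Suc (snd (R ! r))) (fst (R ! r))) (int j - int (snd (R ! r))))"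
proof -
  let ?row = "\<lambda>(x, i). map (\<lambda>j. B (Y @ replicate (Suc i) x) (int j - int i)) [0..<sum_list \<alpha>]"
  \<comment> \<open>The list of blocks is generalised for the induction while the number of columns
    stays \<open>sum_list \<alpha>\<close>.\<close>
  have "concat (map (\<lambda>(x, a). mat_to_list (M Y x a (sum_list \<alpha>))) ps) = map ?row (row_labels ps)"
    for ps
    by (induction ps) (auto simp: row_labels_def mat_to_list_def M_def)
  moreover have "length R = sum_list \<alpha>"
    using assms by (simp add: length_row_labels)
  ultimately show ?thesis
    unfolding H_def mat_of_rows_list_def R_def[symmetric]
    by (intro eq_matI) (auto simp: case_prod_beta R_def)
qed

lemma det_total_weight_H:
  assumes "length X = length \<alpha>"
  shows "det (map_mat total_weight (H Y X \<alpha>))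
       = (\<Prod>(i, j)\<in>{(i, j). i < j \<and> j < length \<alpha>}.
            (var (X ! j) - var (X ! i)) ^ (\<alpha> ! i * \<alpha> ! j))"
proof -
  define ps where "ps = zip (map var X) \<alpha>"
  define R where "R = row_labels (zip X \<alpha>)"
  let ?m = "length R"
  \<comment> \<open>The labels in \<open>R\<close> carry variable names, whereas the Vandermonde
    evaluation needs ring elements as nodes.\<close>
  have R: "row_labels ps = map (map_prod var id) R"
    unfolding R_def ps_def row_labels_def zip_map1
    by (simp add: map_concat comp_def case_prod_beta)
  define V where "V = mat ?m ?m
    (\<lambda>(r, l). of_nat (l choose snd (R ! r)) * var (fst (R ! r)) ^ (l - snd (R ! r)))"
  \<comment> \<open>The variables \<open>Y\<close> enter only through the common factor \<open>\<Prod>y. 1 / (1 - y t)\<close> of the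
    generating functions of the rows, i.e. through a unitriangular Toeplitz matrix.\<close>
  define P where "P = prod_list (map (\<lambda>v. geometric_fps (var v)) Y)"
  define U where "U = mat ?m ?m (\<lambda>(l, j). if l \<le> j then fps_nth P (j - l) else 0)"
  have "fps_nth P 0 = 1"
    unfolding P_def by (induction Y) (auto simp: geometric_fps_def)
  then have "det U = 1"
    by (intro det_unit_upper_triangular[of _ ?m]) (auto simp: U_def)
  moreover have "map_mat total_weight (H Y X \<alpha>) = V * U"
  proof (rule eq_matI)
    fix r j assume "r < dim_row (V * U)" "j < dim_col (V * U)"
    then have rj: "r < ?m" "j < ?m" by (auto simp: V_def U_def)
    obtain x i where xi: "R ! r = (x, i)" by fastforce
    let ?G = "geometric_fps (var x) ^ Suc i"
    \<comment> \<open>The \<open>Suc i\<close> copies of \<open>x\<close> give \<open>?G\<close>,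
      the list \<open>Y\<close> gives \<open>P\<close>, and the offset \<open>- i\<close> becomes
      \<open>fps_X ^ i\<close>.\<close>
    have "total_weight (B (Y @ replicate (Suc i) x) (int j - int i))
        = fps_nth (fps_X ^ i * (?G * P)) j"
    proof (cases "j < i")
      case False
      then have "int j - int i = int (j - i)" by simp
      then show ?thesis
        using False total_weight_B[of "Y @ replicate (Suc i) x" "j - i"]
        by (simp add: fps_X_power_mult_nth P_def mult_ac)
    qed (simp add: total_weight_B_negative fps_X_power_mult_nth)
    \<comment> \<open>Bracketing \<open>P\<close> apart makes the Cauchy product a row of
      \<open>V\<close> times a column of \<open>U\<close>; the zeros of \<open>U\<close> below the
      diagonal then extend the sum to all \<open>l < ?m\<close>.\<close>
    also have "\<dots> = (\<Sum>l=0..j. of_nat (l choose i) * var x ^ (l - i) * fps_nth P (j - l))"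
      unfolding mult.assoc[symmetric]
      by (subst fps_mult_nth) (simp only: fps_nth_X_power_geometric_power)
    also have "\<dots> = (\<Sum>l=0..<?m. of_nat (l choose i) * var x ^ (l - i) *
        (if l \<le> j then fps_nth P (j - l) else 0))"
      using rj by (intro sum.mono_neutral_cong_left) auto
    also have "\<dots> = (V * U) $$ (r, j)"
      using rj by (simp add: V_def U_def scalar_prod_def xi)
    finally show "map_mat total_weight (H Y X \<alpha>) $$ (r, j) = (V * U) $$ (r, j)"
      using rj by (simp add: H_conv_row_labels[OF assms] xi flip: R_def)
  qed (simp_all add: H_conv_row_labels[OF assms] V_def U_def flip: R_def)
  ultimately have "det (map_mat total_weight (H Y X \<alpha>)) = det V"
    using det_mult[of V ?m U] by (simp add: V_def U_def)
  also have "V = mat (length (row_labels ps)) (length (row_labels ps))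
      (\<lambda>(r, l). of_nat (l choose snd (row_labels ps ! r)) *
        fst (row_labels ps ! r) ^ (l - snd (row_labels ps ! r)))"
    by (rule eq_matI) (auto simp: V_def R)
  also have "det \<dots> = (\<Prod>(i, j)\<in>{(i, j). i < j \<and> j < length ps}.
      (fst (ps ! j) - fst (ps ! i)) ^ (snd (ps ! i) * snd (ps ! j)))"
    by (rule det_confluent_vandermonde)
  also have "\<dots> = (\<Prod>(i, j)\<in>{(i, j). i < j \<and> j < length \<alpha>}.
      (var (X ! j) - var (X ! i)) ^ (\<alpha> ! i * \<alpha> ! j))"
    using assms by (intro prod.cong) (auto simp: ps_def)
  finally show ?thesis .
qed

theorem theorem2p27:
  fixes X Y :: "'v list" and \<alpha> :: "nat list"
  assumes "length X = length \<alpha>"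
  shows "\<exists>f. sijection (D (H Y X \<alpha>))
           (sprod {(i, j). i < j \<and> j < length \<alpha>}
             (\<lambda>(i, j). spow (two_sset (var (X ! j)) (- var (X ! i))) (\<alpha> ! i * \<alpha> ! j))) f"
proof (rule sijection_exists)
  let ?I = "{(i, j). i < j \<and> j < length \<alpha>}"
  let ?R = "row_labels (zip X \<alpha>)"
  have fin: "finite ?I"
    by (rule finite_subset[of _ "{..<length \<alpha>} \<times> {..<length \<alpha>}"]) auto
  have factor: "signed_set (two_sset (var v) (- var w))" for v w :: 'v
    by (intro signed_set_two_sset signed_monomial_uminus signed_monomial_var)
  have H: "H Y X \<alpha> \<in> carrier_mat (length ?R) (length ?R)"
    by (simp add: H_conv_row_labels[OF assms])
  have entry: "signed_set (H Y X \<alpha> $$ (i, j))" if "i < length ?R" "j < length ?R" for i j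
    using that by (simp add: H_conv_row_labels[OF assms] signed_set_B)
  show "signed_set (D (H Y X \<alpha>))"
    using H entry by (intro signed_set_D) auto
  show "signed_set (sprod ?I
      (\<lambda>(i, j). spow (two_sset (var (X ! j)) (- var (X ! i))) (\<alpha> ! i * \<alpha> ! j)))"
    using fin by (auto intro!: signed_set_sprod signed_set_spow factor)
  have "total_weight (D (H Y X \<alpha>))
      = (\<Prod>(i, j)\<in>?I. (var (X ! j) - var (X ! i)) ^ (\<alpha> ! i * \<alpha> ! j))"
    using total_weight_D[OF H entry] det_total_weight_H[OF assms] by simp
  \<comment> \<open>Total weight is multiplicative, and each two-element factor contributes a
    difference of variables.\<close>
  also have "\<dots> = total_weight (sprod ?I
      (\<lambda>(i, j). spow (two_sset (var (X ! j)) (- var (X ! i))) (\<alpha> ! i * \<alpha> ! j)))"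
    using fin
    by (subst total_weight_sprod)
      (auto intro!: signed_set_spow factor prod.cong
        simp: total_weight_spow factor total_weight_two_sset)
  finally show "total_weight (D (H Y X \<alpha>)) = total_weight (sprod ?I
      (\<lambda>(i, j). spow (two_sset (var (X ! j)) (- var (X ! i))) (\<alpha> ! i * \<alpha> ! j)))" .
qed

end
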